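(* Let $w>0$ be a fixed positive number and let $n\geq 2$ be an integer. Then $$\inf\left\{r(K)\colon K\subset \mathbb{H}^n\text{ is a convex body with } w(K)\geq w\right\}=0,$$ where $r(K)$ is the inradius and $w(K)$ the minimal Lassak width of $K$.
   Context: $\mathbb{H}^n$ is $n$-dimensional hyperbolic space of curvature $-1$ with geodesic distance $d$. A convex body is a compact, (geodesically) convex set with non-empty interior. The inradius $r(K)$ is the maximal radius of a ball contained in $K$. A hyperplane $H\subset\mathbb{H}^n$ is a supporting hyperplane of $K$ if $H\cap K\neq\emptyset$ and $K$ lies in one of the two closed half-spaces bounded by $H$. The Lassak width of $K$ with respect to a supporting hyperplane $H$ is $\max_{x\in K} d(x,H)$, and the minimal Lassak width $w(K)$ is the minimum of these over all supporting hyperplanes of $K$. *)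

theory Defs
  imports "HOL-Analysis.Analysis"
begin

section \<open>Hyperbolic space: the hyperboloid model\<close>

definition minkowski :: "real \<times> (real ^ 'n) \<Rightarrow> real \<times> (real ^ 'n) \<Rightarrow> real" where
  "minkowski p q = snd p \<bullet> snd q - fst p * fst q"

text \<open>The type variable plays the role of the dimension: the upper sheet of the hyperboloid in
  Minkowski space of dimension \<open>n + 1\<close> is \<open>n\<close>-dimensional hyperbolic space, \<open>n = CARD('n)\<close>.\<close>

typedef (overloaded) ('n :: finite) hyp =
  "{p :: real \<times> (real ^ 'n). minkowski p p = - 1 \<and> 0 < fst p}"
  by (rule exI[of _ "(1, 0)"]) (simp add: minkowski_def)

lemma minkowski_commute: "minkowski p q = minkowski q p"
  by (simp add: minkowski_def inner_commute mult.commute)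

lemma minkowski_Rep_hyp [simp]: "minkowski (Rep_hyp x) (Rep_hyp x) = - 1"
  using Rep_hyp[of x] by simp

lemma fst_Rep_hyp_pos [simp]: "0 < fst (Rep_hyp x)"
  using Rep_hyp[of x] by simp

lemma minkowski_orthogonal_nonneg:
  assumes "minkowski u (Rep_hyp y) = 0"
  shows "0 \<le> minkowski u u"
    and "minkowski u u = 0 \<Longrightarrow> u = 0"
proof -
  define s b c a where "s = fst (Rep_hyp y)" "b = snd (Rep_hyp y)" "c = fst u" "a = snd u"
  note defs = this
  have s: "s > 0" by (simp add: defs)
  have b: "b \<bullet> b = s\<^sup>2 - 1"
    using minkowski_Rep_hyp[of y] by (simp add: minkowski_def defs power2_eq_square)
  have "c * s = a \<bullet> b"
    using assms by (simp add: minkowski_def defs)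
  then have "c\<^sup>2 * s\<^sup>2 \<le> (a \<bullet> a) * (s\<^sup>2 - 1)"
    using Cauchy_Schwarz_ineq[of a b] by (metis b power_mult_distrib)
  then have *: "a \<bullet> a \<le> (a \<bullet> a - c\<^sup>2) * s\<^sup>2"
    by (simp add: algebra_simps)
  have u: "minkowski u u = a \<bullet> a - c\<^sup>2"
    by (simp add: minkowski_def defs power2_eq_square)
  have "0 \<le> (a \<bullet> a - c\<^sup>2) * s\<^sup>2"
    using * inner_ge_zero[of a] by linarith
  then show "0 \<le> minkowski u u"
    using s by (simp add: u zero_le_mult_iff)
  assume "minkowski u u = 0"
  then have "a \<bullet> a - c\<^sup>2 = 0" by (simp add: u)
  with * have "a \<bullet> a \<le> 0" by simp
  then have "a = 0" using inner_gt_zero_iff[of a] by (metis not_less)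
  with \<open>a \<bullet> a - c\<^sup>2 = 0\<close> have "c = 0" by simp
  with \<open>a = 0\<close> show "u = 0" by (simp add: defs prod_eq_iff)
qed

lemma minkowski_add_left: "minkowski (p + q) r = minkowski p r + minkowski q r"
  and minkowski_add_right: "minkowski r (p + q) = minkowski r p + minkowski r q"
  and minkowski_diff_left: "minkowski (p - q) r = minkowski p r - minkowski q r"
  and minkowski_diff_right: "minkowski r (p - q) = minkowski r p - minkowski r q"
  and minkowski_scaleR_left: "minkowski (a *\<^sub>R p) r = a * minkowski p r"
  and minkowski_scaleR_right: "minkowski r (a *\<^sub>R p) = a * minkowski r p"
  by (simp_all add: minkowski_def algebra_simps)

lemmas minkowski_bilinear =
  minkowski_add_left minkowski_add_right minkowski_diff_left minkowski_diff_right
  minkowski_scaleR_left minkowski_scaleR_right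

lemma minkowski_orthogonal_Cauchy_Schwarz:
  assumes "minkowski u (Rep_hyp y) = 0" "minkowski v (Rep_hyp y) = 0"
  shows "(minkowski u v)\<^sup>2 \<le> minkowski u u * minkowski v v"
proof (cases "minkowski v v = 0")
  case True
  then have "v = 0" using assms minkowski_orthogonal_nonneg by blast
  then show ?thesis by (simp add: minkowski_def)
next
  case False
  then have pos: "minkowski v v > 0"
    using minkowski_orthogonal_nonneg(1)[OF assms(2)] by linarith
  define w where "w = minkowski v v *\<^sub>R u - minkowski u v *\<^sub>R v"
  have "minkowski w (Rep_hyp y) = 0"
    by (simp add: w_def minkowski_bilinear assms)
  then have "0 \<le> minkowski w w" by (rule minkowski_orthogonal_nonneg)
  also have "minkowski w w = minkowski v v * (minkowski u u * minkowski v v - (minkowski u v)\<^sup>2)"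
    by (simp add: w_def minkowski_bilinear minkowski_commute[of v u] algebra_simps power2_eq_square)
  finally show ?thesis using pos by (simp add: zero_le_mult_iff)
qed

lemma minkowski_hyp_le: "minkowski (Rep_hyp x) (Rep_hyp y) \<le> - 1"
  and minkowski_hyp_eq_iff: "minkowski (Rep_hyp x) (Rep_hyp y) = - 1 \<longleftrightarrow> x = y"
proof -
  define B where "B = minkowski (Rep_hyp x) (Rep_hyp y)"
  define u where "u = Rep_hyp x + B *\<^sub>R Rep_hyp y"
  have "minkowski u (Rep_hyp y) = 0"
    by (simp add: u_def minkowski_bilinear B_def)
  note u = minkowski_orthogonal_nonneg[OF this]
  have uu: "minkowski u u = B\<^sup>2 - 1"
    by (simp add: u_def minkowski_bilinear B_def minkowski_commute[of "Rep_hyp y"] power2_eq_square)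
  have "B < 0"
  proof -
    have less: "norm (snd (Rep_hyp z)) < fst (Rep_hyp z)" for z :: "'a hyp"
    proof -
      have "(norm (snd (Rep_hyp z)))\<^sup>2 < (fst (Rep_hyp z))\<^sup>2"
        using minkowski_Rep_hyp[of z]
        unfolding minkowski_def power2_norm_eq_inner power2_eq_square[of "fst _"] by linarith
      then show ?thesis
        by (rule power_less_imp_less_base) (simp add: less_imp_le)
    qed
    have "snd (Rep_hyp x) \<bullet> snd (Rep_hyp y) \<le> norm (snd (Rep_hyp x)) * norm (snd (Rep_hyp y))"
      by (rule norm_cauchy_schwarz)
    also have "\<dots> < fst (Rep_hyp x) * fst (Rep_hyp y)"
      by (rule mult_strict_mono) (use less in auto)
    finally show ?thesis by (simp add: B_def minkowski_def)
  qed
  have "1 \<le> B\<^sup>2" using u(1) uu by simp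
  then have "1 \<le> \<bar>B\<bar>" using abs_le_square_iff[of 1 B] by simp
  with \<open>B < 0\<close> show "minkowski (Rep_hyp x) (Rep_hyp y) \<le> - 1"
    by (simp add: B_def)
  show "minkowski (Rep_hyp x) (Rep_hyp y) = - 1 \<longleftrightarrow> x = y"
  proof
    assume "minkowski (Rep_hyp x) (Rep_hyp y) = - 1"
    then have "B = - 1" by (simp add: B_def)
    then have "u = 0" using u(2) uu by simp
    then show "x = y" using \<open>B = - 1\<close> by (simp add: u_def Rep_hyp_inject)
  qed simp
qed

instantiation hyp :: (finite) metric_space
begin

definition dist_hyp :: "'a hyp \<Rightarrow> 'a hyp \<Rightarrow> real" where
  "dist_hyp x y = arcosh (- minkowski (Rep_hyp x) (Rep_hyp y))"

definition uniformity_hyp :: "('a hyp \<times> 'a hyp) filter" where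
  "uniformity_hyp = (INF e\<in>{0 <..}. principal {(x, y). dist x y < e})"

definition open_hyp :: "'a hyp set \<Rightarrow> bool" where
  "open_hyp U \<longleftrightarrow> (\<forall>x\<in>U. eventually (\<lambda>(x', y). x' = x \<longrightarrow> y \<in> U) uniformity)"

instance
proof
  fix x y z :: "'a hyp"
  let ?b = "\<lambda>x y. - minkowski (Rep_hyp x) (Rep_hyp y)"
  have ge: "?b x y \<ge> 1" for x y :: "'a hyp" using minkowski_hyp_le[of x y] by linarith
  have cosh: "cosh (dist x y) = ?b x y" for x y :: "'a hyp"
    using ge[of x y] by (simp add: dist_hyp_def cosh_arcosh_real)
  have nonneg: "0 \<le> dist x y" for x y :: "'a hyp"
    using ge[of x y] by (simp add: dist_hyp_def arcosh_nonneg_real)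
  have sinh: "sinh (dist x y) = sqrt ((?b x y)\<^sup>2 - 1)" for x y :: "'a hyp"
    using nonneg[of x y] hyperbolic_pythagoras[of "dist x y"]
    by (intro real_sqrt_unique[symmetric]) (simp_all add: cosh[symmetric])
  show "(dist x y = 0) = (x = y)"
  proof -
    have "dist x y = 0 \<longleftrightarrow> cosh (dist x y) = cosh 0"
      using nonneg[of x y] cosh_real_nonneg_less_iff[of 0 "dist x y"] by force
    also have "\<dots> \<longleftrightarrow> minkowski (Rep_hyp x) (Rep_hyp y) = - 1"
      unfolding cosh by auto
    finally show ?thesis by (simp add: minkowski_hyp_eq_iff)
  qed
  show "dist x y \<le> dist x z + dist y z"
  proof -
    define u where "u = Rep_hyp x - ?b x z *\<^sub>R Rep_hyp z"
    define v where "v = Rep_hyp y - ?b y z *\<^sub>R Rep_hyp z"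
    have u: "minkowski u (Rep_hyp z) = 0" and v: "minkowski v (Rep_hyp z) = 0"
      by (simp_all add: u_def v_def minkowski_bilinear)
    have uu: "minkowski u u = (?b x z)\<^sup>2 - 1" and vv: "minkowski v v = (?b y z)\<^sup>2 - 1"
      and uv: "minkowski u v = ?b x z * ?b y z - ?b x y"
      by (simp_all add: u_def v_def minkowski_bilinear minkowski_commute[of "Rep_hyp z"]
          power2_eq_square)
    have "- minkowski u v \<le> \<bar>minkowski u v\<bar>" by simp
    also have "\<dots> \<le> sqrt (minkowski u u * minkowski v v)"
      using minkowski_orthogonal_Cauchy_Schwarz[OF u v] by (metis real_sqrt_abs real_sqrt_le_iff)
    also have "\<dots> = sinh (dist x z) * sinh (dist y z)"
      by (simp add: sinh uu vv real_sqrt_mult)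
    finally have "cosh (dist x y) \<le> cosh (dist x z + dist y z)"
      unfolding cosh_add by (simp add: cosh uv)
    then show ?thesis
      using nonneg cosh_real_nonneg_le_iff by (metis add_nonneg_nonneg)
  qed
qed (simp_all add: uniformity_hyp_def open_hyp_def)

end


section \<open>Convex bodies, inradius and minimal Lassak width\<close>

definition geodesic_on :: "real \<Rightarrow> (real \<Rightarrow> 'a :: metric_space) \<Rightarrow> bool" where
  "geodesic_on l g \<longleftrightarrow> (\<forall>s\<in>{0..l}. \<forall>t\<in>{0..l}. dist (g s) (g t) = \<bar>s - t\<bar>)"

definition geodesically_convex :: "'a :: metric_space set \<Rightarrow> bool" where
  "geodesically_convex K \<longleftrightarrow>
    (\<forall>l\<ge>0. \<forall>g. geodesic_on l g \<and> g 0 \<in> K \<and> g l \<in> K \<longrightarrow> g ` {0..l} \<subseteq> K)"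

definition convex_body :: "'n :: finite hyp set \<Rightarrow> bool" where
  "convex_body K \<longleftrightarrow> compact K \<and> geodesically_convex K \<and> interior K \<noteq> {}"

definition inradius :: "'n :: finite hyp set \<Rightarrow> real" where
  "inradius K = Sup {r. 0 \<le> r \<and> (\<exists>c. cball c r \<subseteq> K)}"

text \<open>Hyperplanes (totally geodesic hypersurfaces) are the non-empty intersections of the hyperboloid
  with linear hyperplanes of Minkowski space, i.e. those whose normal vector \<open>v\<close> is spacelike,
  \<open>minkowski v v > 0\<close>. The closed half-spaces bounded by \<open>hyp_hyperplane v\<close> are
  \<open>hyp_halfspace v\<close> and \<open>hyp_halfspace (- v)\<close>.\<close>

definition hyp_hyperplane :: "real \<times> (real ^ 'n) \<Rightarrow> 'n :: finite hyp set" where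
  "hyp_hyperplane v = {x. minkowski v (Rep_hyp x) = 0}"

definition hyp_halfspace :: "real \<times> (real ^ 'n) \<Rightarrow> 'n :: finite hyp set" where
  "hyp_halfspace v = {x. minkowski v (Rep_hyp x) \<le> 0}"

definition supporting_hyperplane :: "'n :: finite hyp set \<Rightarrow> 'n hyp set \<Rightarrow> bool" where
  "supporting_hyperplane K H \<longleftrightarrow> H \<inter> K \<noteq> {} \<and>
    (\<exists>v. minkowski v v > 0 \<and> H = hyp_hyperplane v \<and>
      (K \<subseteq> hyp_halfspace v \<or> K \<subseteq> hyp_halfspace (- v)))"

definition lassak_width :: "'n :: finite hyp set \<Rightarrow> 'n hyp set \<Rightarrow> real" where
  "lassak_width K H = (SUP x\<in>K. infdist x H)"

definition min_lassak_width :: "'n :: finite hyp set \<Rightarrow> real" where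
  "min_lassak_width K = (INF H\<in>{H. supporting_hyperplane K H}. lassak_width K H)"

end

theory Submission
  imports Defs
begin

text \<open>Write \<open>x\<^sub>0\<close> for the time coordinate and \<open>x\<^sub>j\<close> for the space coordinates of a point of the
  hyperboloid, and \<open>o = (1, 0)\<close>. For a unit spacelike vector \<open>v\<close>, \<open>arsinh (minkowski v x)\<close> is the signed
  distance of \<open>x\<close> from the hyperplane normal to \<open>v\<close>; and \<open>x\<^sub>0 = cosh (dist o x)\<close>. The bodies used are
  \<open>K = {x. \<bar>x\<^sub>j\<bar> \<le> sinh \<delta> \<and> x\<^sub>0 \<le> M}\<close>: the part of the \<open>\<delta>\<close>-neighbourhood of a hyperplane that lies in
  a large ball around \<open>o\<close>. They can be thin and still wide because a supporting hyperplane
  diverges exponentially from the boundary of such a neighbourhood.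

  Thin: from any centre, moving by \<open>r\<close> perpendicularly to the hyperplane \<open>x\<^sub>j = 0\<close>, away from it,
  gives a point at distance at least \<open>r\<close> from it, so that a ball in \<open>K\<close> has radius at most \<open>\<delta>\<close>
  (\<open>cball_subset_truncated_slab_radius_le\<close>).

  Wide: let \<open>K\<close> lie on the negative side of the hyperplane normal to the unit vector \<open>v\<close>. As \<open>K\<close>
  contains the ball of radius \<open>\<delta>\<close> around \<open>o\<close>, \<open>minkowski v o \<le> - sinh \<delta>\<close>. For \<open>i \<noteq> j\<close>, \<open>K\<close> also contains
  the two points \<open>a\<close>, \<open>b\<close> of the \<open>i\<close>-th coordinate geodesic with \<open>x\<^sub>0 = M\<close>. In Minkowski space
  \<open>a + b = 2 M o\<close>, so at one of them \<open>minkowski v\<close> is at most \<open>- M sinh \<delta>\<close>, and its distance from the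
  hyperplane is at least \<open>arsinh (M sinh \<delta>)\<close>. With \<open>\<delta>\<close> fixed, a large \<open>M\<close> makes this at least
  \<open>w\<close> (\<open>lassak_width_truncated_slab_ge\<close>); then \<open>\<delta>\<close> tends to \<open>0\<close>.

  That \<open>K\<close> is convex comes from the form of a geodesic: its points are combinations of its end points
  with nonnegative coefficients of sum at most \<open>1\<close>, so that a condition \<open>minkowski u x \<le> c\<close> with
  \<open>c \<ge> 0\<close> passes from the end points to the whole geodesic
  (\<open>geodesically_convex_minkowski_sublevel\<close>).\<close>


section \<open>Points of the hyperboloid\<close>

lemma cosh_dist_hyp: "cosh (dist x y) = - minkowski (Rep_hyp x) (Rep_hyp y)"
  using minkowski_hyp_le[of x y] by (simp add: dist_hyp_def cosh_arcosh_real)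

lemma norm_snd_less_abs_fst:
  assumes "minkowski p p = - 1"
  shows "norm (snd p) < \<bar>fst p\<bar>"
proof -
  have "(norm (snd p))\<^sup>2 < \<bar>fst p\<bar>\<^sup>2"
    using assms unfolding minkowski_def power2_norm_eq_inner by (simp add: power2_eq_square)
  then show ?thesis
    by (rule power_less_imp_less_base) simp
qed

text \<open>Two nonzero causal vectors have a negative product only if they point to the same side of the light
  cone. This places a vector on the upper sheet without computing its time coordinate.\<close>

lemma fst_pos_if_minkowski_neg:
  assumes p: "minkowski p p = - 1" and neg: "minkowski p (Rep_hyp c) < 0"
  shows "0 < fst p"
proof (rule ccontr)
  assume "\<not> 0 < fst p"
  then have "norm (snd p) \<le> - fst p"
    using norm_snd_less_abs_fst[OF p] by simp
  moreover have "norm (snd (Rep_hyp c)) \<le> fst (Rep_hyp c)"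
    using norm_snd_less_abs_fst[of "Rep_hyp c"] fst_Rep_hyp_pos[of c] by simp
  ultimately have "norm (snd p) * norm (snd (Rep_hyp c)) \<le> - fst p * fst (Rep_hyp c)"
    using \<open>\<not> 0 < fst p\<close> by (intro mult_mono) auto
  then show False
    using neg Cauchy_Schwarz_ineq2[of "snd p" "snd (Rep_hyp c)"] by (simp add: minkowski_def)
qed

lemma Rep_Abs_hyp:
  assumes "minkowski p p = - 1" and "minkowski p (Rep_hyp c) < 0"
  shows "Rep_hyp (Abs_hyp p) = p"
proof (rule Abs_hyp_inverse)
  show "p \<in> {p. minkowski p p = - 1 \<and> 0 < fst p}"
    using assms(1) fst_pos_if_minkowski_neg[OF assms] by blast
qed

lemma fst_Rep_hyp: "fst (Rep_hyp x) = sqrt (1 + snd (Rep_hyp x) \<bullet> snd (Rep_hyp x))"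
proof (rule real_sqrt_unique[symmetric])
  show "(fst (Rep_hyp x))\<^sup>2 = 1 + snd (Rep_hyp x) \<bullet> snd (Rep_hyp x)"
    using minkowski_Rep_hyp[of x] unfolding minkowski_def power2_eq_square by linarith
qed (rule less_imp_le[OF fst_Rep_hyp_pos])

text \<open>Vertical projection identifies hyperbolic space with \<open>real ^ 'n\<close>. The inverse of this chart carries
  compactness over from Euclidean space.\<close>

lemma Rep_hyp_graph:
  "Rep_hyp (Abs_hyp (sqrt (1 + y \<bullet> y), y)) = (sqrt (1 + y \<bullet> y), y)"
  by (intro Abs_hyp_inverse) (auto simp: minkowski_def add_pos_nonneg)

lemma continuous_on_hyp_graph:
  "continuous_on S (\<lambda>y. Abs_hyp (sqrt (1 + y \<bullet> y), y :: real ^ 'n :: finite))"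
proof -
  let ?\<phi> = "\<lambda>y. Abs_hyp (sqrt (1 + y \<bullet> y), y :: real ^ 'n)"
  define m where "m y z = sqrt (1 + y \<bullet> y) * sqrt (1 + z \<bullet> z) - y \<bullet> z" for y z :: "real ^ 'n"
  have m: "- minkowski (Rep_hyp (?\<phi> y)) (Rep_hyp (?\<phi> z)) = m y z" for y z
    by (simp add: Rep_hyp_graph minkowski_def m_def)
  have ge: "1 \<le> m y z" for y z
    using minkowski_hyp_le[of "?\<phi> y" "?\<phi> z"] m[of y z] by linarith
  have "(\<lambda>y. ?\<phi> y) \<midarrow>z\<rightarrow> ?\<phi> z" for z
  proof -
    have "isCont (\<lambda>y. m y z) z" unfolding m_def by (intro continuous_intros)
    then have "(\<lambda>y. m y z) \<midarrow>z\<rightarrow> m z z" by (simp add: isCont_def)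
    moreover have "m z z = 1" by (simp add: m_def)
    ultimately have "(\<lambda>y. m y z) \<midarrow>z\<rightarrow> 1" by simp
    then have "(\<lambda>y. arcosh (m y z)) \<midarrow>z\<rightarrow> arcosh 1"
      using ge by (intro tendsto_arcosh_strong) auto
    then have "(\<lambda>y. dist (?\<phi> y) (?\<phi> z)) \<midarrow>z\<rightarrow> 0"
      by (simp add: dist_hyp_def m)
    then show ?thesis by (rule tendsto_dist_iff[THEN iffD2])
  qed
  then show ?thesis by (simp add: continuous_at_imp_continuous_on isCont_def)
qed


section \<open>Geodesics and convexity\<close>

text \<open>The product of the right-hand side with \<open>g t\<close> is \<open>- 1\<close>, which for two points of the hyperboloid means
  that they agree. So a curve that is only assumed to be distance-preserving is already determined by
  its end points.\<close>

lemma geodesic_on_formula: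
  assumes g: "geodesic_on l g" and l: "0 < l" and t: "t \<in> {0..l}"
  shows "Rep_hyp (g t) =
    (sinh (l - t) / sinh l) *\<^sub>R Rep_hyp (g 0) + (sinh t / sinh l) *\<^sub>R Rep_hyp (g l)"
    (is "_ = ?p")
proof -
  have dist_g: "minkowski (Rep_hyp (g s)) (Rep_hyp (g u)) = - cosh (s - u)"
    if "s \<in> {0..l}" "u \<in> {0..l}" for s u
    using cosh_dist_hyp[of "g s" "g u"] g that
    by (simp add: geodesic_on_def cosh_real_abs)
  have m: "minkowski (Rep_hyp (g 0)) (Rep_hyp (g l)) = - cosh l"
    "minkowski (Rep_hyp (g l)) (Rep_hyp (g 0)) = - cosh l"
    "minkowski (Rep_hyp (g 0)) (Rep_hyp (g t)) = - cosh t"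
    "minkowski (Rep_hyp (g l)) (Rep_hyp (g t)) = - cosh (l - t)"
    using dist_g[of 0 l] dist_g[of l 0] dist_g[of 0 t] dist_g[of l t] l t by simp_all
  have sl: "sinh l > 0" using l by simp
  have add: "sinh l = sinh (l - t) * cosh t + cosh (l - t) * sinh t"
    using sinh_add[of "l - t" t] by simp
  have "minkowski ?p (Rep_hyp (g t)) =
      - ((sinh (l - t) * cosh t + cosh (l - t) * sinh t) / sinh l)"
    by (simp add: minkowski_bilinear m add_divide_distrib)
  also have "\<dots> = - 1" using sl add[symmetric] by simp
  finally have pt: "minkowski ?p (Rep_hyp (g t)) = - 1" .
  have cosh_l: "cosh l = cosh (l - t) * cosh t + sinh (l - t) * sinh t"
    using cosh_add[of "l - t" t] by simp
  define a b c d where "a = sinh (l - t)" "b = cosh (l - t)" "c = sinh t" "d = cosh t"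
  note abcd = this
  have h: "b\<^sup>2 = a\<^sup>2 + 1" "d\<^sup>2 = c\<^sup>2 + 1"
    by (simp_all add: abcd cosh_square_eq)
  have "minkowski ?p ?p * (sinh l)\<^sup>2 = - (a\<^sup>2 + c\<^sup>2 + 2 * a * c * cosh l)"
    using sl by (simp add: minkowski_bilinear m abcd field_simps power2_eq_square)
  also have "\<dots> = - (sinh l)\<^sup>2"
    using h unfolding add cosh_l abcd[symmetric] by algebra
  finally have "minkowski ?p ?p = - 1"
    using sl mult_right_cancel[of "(sinh l)\<^sup>2" "minkowski ?p ?p" "- 1"] by simp
  then have "Rep_hyp (Abs_hyp ?p) = ?p"
    using pt by (intro Rep_Abs_hyp[where c = "g t"]) auto
  then have "Abs_hyp ?p = g t"
    using pt minkowski_hyp_eq_iff[of "Abs_hyp ?p" "g t"] by simp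
  with \<open>Rep_hyp (Abs_hyp ?p) = ?p\<close> show ?thesis by simp
qed

text \<open>The coefficients in the formula for a geodesic have sum at most \<open>1\<close>, because
  \<open>sinh (l - t) + sinh t \<le> sinh l\<close>. As the sum can be smaller than \<open>1\<close>, \<open>c \<ge> 0\<close>
  is needed for spacelike \<open>u\<close>: for \<open>c = 0\<close> the set is a half-space, for \<open>c > 0\<close> an equidistant
  neighbourhood of one, and for \<open>c < 0\<close> the points deeper inside it than
  an equidistant hypersurface, which is not convex. With \<open>u\<close> on the lower sheet and \<open>c \<ge> 1\<close> the set is a
  closed ball.\<close>

lemma geodesically_convex_minkowski_sublevel:
  assumes "0 \<le> c"
  shows "geodesically_convex {x. minkowski u (Rep_hyp x) \<le> c}"
  unfolding geodesically_convex_def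
proof (intro allI impI subsetI)
  fix l :: real and g :: "real \<Rightarrow> 'a hyp" and x
  assume l: "0 \<le> l" and g: "geodesic_on l g \<and> g 0 \<in> {x. minkowski u (Rep_hyp x) \<le> c} \<and>
      g l \<in> {x. minkowski u (Rep_hyp x) \<le> c}"
    and "x \<in> g ` {0..l}"
  then obtain t where t: "t \<in> {0..l}" "x = g t" by auto
  show "x \<in> {x. minkowski u (Rep_hyp x) \<le> c}"
  proof (cases "l = 0")
    case True
    then show ?thesis using t g by simp
  next
    case False
    then have l: "0 < l" using l by simp
    have s: "0 < sinh l" "0 \<le> sinh t" "0 \<le> sinh (l - t)" using l t by simp_all
    have "sinh l = sinh (l - t) * cosh t + cosh (l - t) * sinh t"
      using sinh_add[of "l - t" t] by simp
    moreover have "sinh (l - t) * 1 \<le> sinh (l - t) * cosh t" "1 * sinh t \<le> cosh (l - t) * sinh t"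
      using s cosh_real_ge_1 by (intro mult_left_mono mult_right_mono; simp)+
    ultimately have sum: "sinh (l - t) + sinh t \<le> sinh l" by linarith
    have "minkowski u (Rep_hyp x) * sinh l =
        sinh (l - t) * minkowski u (Rep_hyp (g 0)) + sinh t * minkowski u (Rep_hyp (g l))"
      using s unfolding t(2) geodesic_on_formula[OF conjunct1[OF g] l t(1)]
      by (simp add: minkowski_bilinear field_simps)
    also have "\<dots> \<le> sinh (l - t) * c + sinh t * c"
      using g s by (intro add_mono mult_left_mono) auto
    also have "\<dots> \<le> c * sinh l"
      using mult_left_mono[OF sum assms] by (simp add: algebra_simps)
    finally show ?thesis using s by simp
  qed
qed

lemma geodesically_convex_Int:
  assumes "geodesically_convex A" "geodesically_convex B"
  shows "geodesically_convex (A \<inter> B)"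
  unfolding geodesically_convex_def
proof (intro allI impI Int_greatest)
  fix l :: real and g :: "real \<Rightarrow> 'a"
  assume l: "0 \<le> l" and g: "geodesic_on l g \<and> g 0 \<in> A \<inter> B \<and> g l \<in> A \<inter> B"
  show "g ` {0..l} \<subseteq> A"
    by (rule assms(1)[unfolded geodesically_convex_def, rule_format, OF l]) (use g in simp)
  show "g ` {0..l} \<subseteq> B"
    by (rule assms(2)[unfolded geodesically_convex_def, rule_format, OF l]) (use g in simp)
qed


section \<open>Distances from hyperplanes\<close>

text \<open>Along the unit-speed geodesic through \<open>c\<close> perpendicular to the hyperplane with normal \<open>v\<close>, the signed
  distance from that hyperplane grows at unit rate. Only the end point of the geodesic is needed.\<close>

lemma move_perpendicular:
  assumes v: "minkowski v v = 1"
  obtains q where "dist c q = \<bar>r\<bar>"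
    and "arsinh (minkowski v (Rep_hyp q)) = arsinh (minkowski v (Rep_hyp c)) + r"
proof -
  define a where "a = minkowski v (Rep_hyp c)"
  define \<rho> where "\<rho> = arsinh a"
  have a: "a = sinh \<rho>" by (simp add: \<rho>_def)
  \<comment> \<open>The unit tangent vector at \<open>c\<close> in the direction of steepest growth: the normalised projection of
    \<open>v\<close> to the tangent space.\<close>
  define u where "u = (1 / cosh \<rho>) *\<^sub>R (v + a *\<^sub>R Rep_hyp c)"
  have ch: "(cosh \<rho>)\<^sup>2 = a\<^sup>2 + 1" by (simp add: a cosh_square_eq)
  have chp: "cosh \<rho> > 0" by simp
  have uc: "minkowski u (Rep_hyp c) = 0"
    by (simp add: u_def minkowski_bilinear a_def)
  have vu: "minkowski v u = cosh \<rho>"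
    using ch chp by (simp add: u_def minkowski_bilinear v a_def[symmetric] field_simps power2_eq_square)
  have "minkowski u u * (cosh \<rho>)\<^sup>2 = (cosh \<rho>)\<^sup>2"
    unfolding ch using chp ch
    by (simp add: u_def minkowski_bilinear minkowski_commute[of "Rep_hyp c" v] v a_def[symmetric]
        field_simps power2_eq_square)
  then have uu: "minkowski u u = 1" using chp by simp
  define p where "p = cosh r *\<^sub>R Rep_hyp c + sinh r *\<^sub>R u"
  have "minkowski p p = - (cosh r)\<^sup>2 + (sinh r)\<^sup>2"
    by (simp add: p_def minkowski_bilinear uc uu minkowski_commute[of "Rep_hyp c" u] power2_eq_square)
  then have pp: "minkowski p p = - 1" by (simp add: cosh_square_eq)
  have pc: "minkowski p (Rep_hyp c) = - cosh r"
    by (simp add: p_def minkowski_bilinear uc)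
  then have q: "Rep_hyp (Abs_hyp p) = p"
    using pp by (intro Rep_Abs_hyp[where c = c]) auto
  have "cosh (dist c (Abs_hyp p)) = cosh \<bar>r\<bar>"
    by (simp add: cosh_dist_hyp q minkowski_commute[of "Rep_hyp c" p] pc cosh_real_abs)
  then have "dist c (Abs_hyp p) = \<bar>r\<bar>"
    using cosh_real_nonneg_less_iff[of "\<bar>r\<bar>" "dist c (Abs_hyp p)"]
      cosh_real_nonneg_less_iff[of "dist c (Abs_hyp p)" "\<bar>r\<bar>"] by force
  moreover have "minkowski v (Rep_hyp (Abs_hyp p)) = sinh (\<rho> + r)"
    unfolding q by (simp add: p_def minkowski_bilinear vu a_def[symmetric] a sinh_add)
  ultimately show thesis
    by (intro that[of "Abs_hyp p"]) (simp_all add: a_def[symmetric] \<rho>_def[symmetric] arsinh_sinh_real)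
qed

text \<open>Both \<open>v\<close> and the component of \<open>x\<close> orthogonal to \<open>h\<close> lie in the tangent space at \<open>h\<close>, on which the
  Minkowski form is positive definite. The component has length \<open>sinh (dist x h)\<close>, and Cauchy-Schwarz
  bounds its product with \<open>v\<close>.\<close>

lemma minkowski_le_sinh_dist_hyperplane:
  assumes v: "minkowski v v = 1" and h: "h \<in> hyp_hyperplane v"
  shows "\<bar>minkowski v (Rep_hyp x)\<bar> \<le> sinh (dist x h)"
proof -
  define u where "u = Rep_hyp x - cosh (dist x h) *\<^sub>R Rep_hyp h"
  have vh: "minkowski v (Rep_hyp h) = 0" using h by (simp add: hyp_hyperplane_def)
  have uh: "minkowski u (Rep_hyp h) = 0"
    by (simp add: u_def minkowski_bilinear cosh_dist_hyp)
  have vu: "minkowski v u = minkowski v (Rep_hyp x)"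
    by (simp add: u_def minkowski_bilinear vh)
  have "minkowski u u = (cosh (dist x h))\<^sup>2 - 1"
    by (simp add: u_def minkowski_bilinear cosh_dist_hyp minkowski_commute[of "Rep_hyp h"]
        power2_eq_square)
  then have uu: "minkowski u u = (sinh (dist x h))\<^sup>2" by (simp add: cosh_square_eq)
  have "\<bar>minkowski v (Rep_hyp x)\<bar>\<^sup>2 \<le> (sinh (dist x h))\<^sup>2"
    using minkowski_orthogonal_Cauchy_Schwarz[OF vh uh] by (simp add: v vu uu)
  then show ?thesis by (rule power2_le_imp_le) simp
qed


section \<open>Inradius and width of convex bodies\<close>

lemma unit_axis: "minkowski (0, axis j 1) (0, axis j 1) = (1 :: real)"
  by (simp add: minkowski_def inner_axis')

text \<open>The supremum of an unbounded set of reals would be an arbitrary number. A ball of radius \<open>r\<close> contains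
  a point at distance exactly \<open>r\<close> from its centre, so the radii of balls in \<open>K\<close> are bounded by its diameter.\<close>

lemma inradius_nonneg:
  assumes "convex_body K"
  shows "0 \<le> inradius K"
proof -
  obtain x where x: "x \<in> K" using assms interior_subset unfolding convex_body_def by blast
  have bd: "bounded K" using assms by (simp add: convex_body_def compact_imp_bounded)
  show ?thesis
    unfolding inradius_def
  proof (rule cSup_upper)
    have "cball x 0 \<subseteq> K" using x by simp
    then show "0 \<in> {r. 0 \<le> r \<and> (\<exists>c. cball c r \<subseteq> K)}" by blast
    have "r \<le> diameter K" if r: "0 \<le> r" "cball c r \<subseteq> K" for r c
    proof -
      obtain q where "dist c q = \<bar>r\<bar>"
        using move_perpendicular[OF unit_axis] by blast
      then show ?thesis
        using diameter_bounded_bound[OF bd, of c q] subsetD[OF r(2), of q] subsetD[OF r(2), of c] r(1)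
        by simp
    qed
    then show "bdd_above {r. 0 \<le> r \<and> (\<exists>c. cball c r \<subseteq> K)}"
      by (intro bdd_aboveI[of _ "diameter K"]) auto
  qed
qed

lemma supporting_hyperplane_unit_normal:
  assumes "supporting_hyperplane K H"
  obtains v where "minkowski v v = 1" "H = hyp_hyperplane v" "K \<subseteq> hyp_halfspace v"
proof -
  obtain u where u: "minkowski u u > 0" "H = hyp_hyperplane u"
      "K \<subseteq> hyp_halfspace u \<or> K \<subseteq> hyp_halfspace (- u)"
    using assms unfolding supporting_hyperplane_def by blast
  define s where "s = 1 / sqrt (minkowski u u)"
  have s: "s > 0" "s * s * minkowski u u = 1"
    using u by (simp_all add: s_def)
  have neg: "minkowski (- u) x = - minkowski u x" "minkowski x (- u) = - minkowski x u" for x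
    by (simp_all add: minkowski_def)
  from u(3) show thesis
  proof
    assume "K \<subseteq> hyp_halfspace u"
    then show thesis
      using s u by (intro that[of "s *\<^sub>R u"])
        (auto simp: hyp_hyperplane_def hyp_halfspace_def minkowski_bilinear mult_le_0_iff)
  next
    assume "K \<subseteq> hyp_halfspace (- u)"
    then show thesis
      using s u by (intro that[of "(- s) *\<^sub>R u"])
        (auto simp: hyp_hyperplane_def hyp_halfspace_def minkowski_bilinear neg mult_le_0_iff
          simp del: scaleR_minus_left)
  qed
qed

lemma lassak_width_ge:
  assumes v: "minkowski v v = 1" and K: "bounded K" "hyp_hyperplane v \<inter> K \<noteq> {}"
    and x: "x \<in> K" "sinh w \<le> \<bar>minkowski v (Rep_hyp x)\<bar>"
  shows "w \<le> lassak_width K (hyp_hyperplane v)"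
proof -
  obtain h where h: "h \<in> hyp_hyperplane v" "h \<in> K" using K by blast
  have "w \<le> dist x y" if "y \<in> hyp_hyperplane v" for y
    using minkowski_le_sinh_dist_hyperplane[OF v that, of x] x(2)
    by (meson order_trans sinh_real_le_iff)
  then have "w \<le> infdist x (hyp_hyperplane v)"
    using h unfolding infdist_def by (auto intro!: cINF_greatest)
  also have "\<dots> \<le> lassak_width K (hyp_hyperplane v)"
    unfolding lassak_width_def
  proof (rule cSUP_upper[OF x(1)])
    have "infdist y (hyp_hyperplane v) \<le> diameter K" if "y \<in> K" for y
      using infdist_le[OF h(1), of y] diameter_bounded_bound[OF K(1) that h(2)] by linarith
    then show "bdd_above ((\<lambda>y. infdist y (hyp_hyperplane v)) ` K)"
      by (intro bdd_aboveI[of _ "diameter K"]) auto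
  qed
  finally show ?thesis .
qed


section \<open>Truncated slabs\<close>

definition hyp_origin :: "'n :: finite hyp" where
  "hyp_origin = Abs_hyp (1, 0)"

lemma Rep_hyp_origin [simp]: "Rep_hyp hyp_origin = (1, 0)"
  unfolding hyp_origin_def by (rule Abs_hyp_inverse) (simp add: minkowski_def)

text \<open>The first condition says that the distance of \<open>x\<close> from the hyperplane \<open>x\<^sub>j = 0\<close> is at most \<open>\<delta>\<close>, the
  second, for \<open>M \<ge> 1\<close>, that \<open>x\<close> lies in the ball around the origin whose radius has hyperbolic cosine \<open>M\<close>.\<close>

definition truncated_slab :: "'n \<Rightarrow> real \<Rightarrow> real \<Rightarrow> 'n :: finite hyp set" where
  "truncated_slab j \<delta> M = {x. \<bar>snd (Rep_hyp x) $ j\<bar> \<le> sinh \<delta> \<and> fst (Rep_hyp x) \<le> M}"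

lemma compact_truncated_slab: "compact (truncated_slab j \<delta> M)"
proof -
  let ?\<phi> = "\<lambda>y. Abs_hyp (sqrt (1 + y \<bullet> y), y)"
  define S where "S = {y :: real ^ 'a. \<bar>y $ j\<bar> \<le> sinh \<delta> \<and> sqrt (1 + y \<bullet> y) \<le> M}"
  have "closed S"
    unfolding S_def by (intro closed_Collect_conj closed_Collect_le continuous_intros)
  moreover have "S \<subseteq> cball 0 M"
  proof
    fix y assume "y \<in> S"
    then have "sqrt (1 + y \<bullet> y) \<le> M" by (simp add: S_def)
    moreover have "norm y \<le> sqrt (1 + y \<bullet> y)" by (simp add: norm_eq_sqrt_inner)
    ultimately show "y \<in> cball 0 M" by simp
  qed
  ultimately have "compact S"
    using compact_eq_bounded_closed bounded_subset bounded_cball by blast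
  then have "compact (?\<phi> ` S)"
    by (rule compact_continuous_image[OF continuous_on_hyp_graph])
  moreover have "?\<phi> ` S = truncated_slab j \<delta> M"
  proof (intro equalityI subsetI)
    fix x assume "x \<in> ?\<phi> ` S"
    then obtain y where y: "y \<in> S" "x = ?\<phi> y" by auto
    then show "x \<in> truncated_slab j \<delta> M"
      by (simp add: truncated_slab_def S_def Rep_hyp_graph)
  next
    fix x :: "'a hyp" assume "x \<in> truncated_slab j \<delta> M"
    then have "snd (Rep_hyp x) \<in> S" by (simp add: truncated_slab_def S_def fst_Rep_hyp)
    moreover have "x = ?\<phi> (snd (Rep_hyp x))"
      by (simp add: fst_Rep_hyp[symmetric] Rep_hyp_inverse)
    ultimately show "x \<in> ?\<phi> ` S" by (rule rev_image_eqI)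
  qed
  ultimately show ?thesis by simp
qed

lemma geodesically_convex_truncated_slab:
  assumes "0 \<le> \<delta>" "0 \<le> M"
  shows "geodesically_convex (truncated_slab j \<delta> M)"
proof -
  let ?L = "\<lambda>u c. {x. minkowski u (Rep_hyp x) \<le> c}"
  have "truncated_slab j \<delta> M =
      ?L (0, axis j 1) (sinh \<delta>) \<inter> ?L (0, - axis j 1) (sinh \<delta>) \<inter> ?L (- 1, 0) M"
    by (auto simp: truncated_slab_def minkowski_def inner_axis' abs_le_iff)
  then show ?thesis
    using assms
    by (auto intro!: geodesically_convex_Int geodesically_convex_minkowski_sublevel)
qed

lemma cball_subset_truncated_slab:
  assumes "0 \<le> \<delta>" "cosh \<delta> \<le> M"
  shows "cball hyp_origin \<delta> \<subseteq> truncated_slab j \<delta> M"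
proof
  fix x :: "'a hyp" assume "x \<in> cball hyp_origin \<delta>"
  then have "cosh (dist hyp_origin x) \<le> cosh \<delta>"
    by (simp add: cosh_real_nonneg_le_iff assms)
  then have f: "fst (Rep_hyp x) \<le> cosh \<delta>"
    by (simp add: cosh_dist_hyp minkowski_def)
  have "\<bar>snd (Rep_hyp x) $ j\<bar>\<^sup>2 \<le> (norm (snd (Rep_hyp x)))\<^sup>2"
    by (intro power_mono component_le_norm_cart) simp
  also have "\<dots> = (fst (Rep_hyp x))\<^sup>2 - 1"
    by (simp add: fst_Rep_hyp power2_norm_eq_inner)
  also have "\<dots> \<le> (cosh \<delta>)\<^sup>2 - 1"
    using f less_imp_le[OF fst_Rep_hyp_pos[of x]] by (simp add: power_mono)
  also have "\<dots> = (sinh \<delta>)\<^sup>2" by (simp add: cosh_square_eq)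
  finally have "\<bar>snd (Rep_hyp x) $ j\<bar> \<le> sinh \<delta>"
    by (rule power2_le_imp_le) (simp add: assms)
  then show "x \<in> truncated_slab j \<delta> M"
    using f assms by (simp add: truncated_slab_def)
qed

lemma convex_body_truncated_slab:
  assumes "0 < \<delta>" "cosh \<delta> \<le> M"
  shows "convex_body (truncated_slab j \<delta> M)"
proof -
  have "ball hyp_origin \<delta> \<subseteq> truncated_slab j \<delta> M"
    using cball_subset_truncated_slab[of \<delta> M j] assms ball_subset_cball by fastforce
  then have "hyp_origin \<in> interior (truncated_slab j \<delta> M)"
    using assms by (meson centre_in_ball interiorI open_ball)
  moreover have "0 \<le> M" using assms cosh_real_ge_1[of \<delta>] by linarith
  ultimately show ?thesis
    unfolding convex_body_def using assms
    by (auto intro: compact_truncated_slab geodesically_convex_truncated_slab)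
qed

text \<open>The signed distance from the hyperplane \<open>x\<^sub>j = 0\<close> takes values in \<open>[- \<delta>, \<delta>]\<close> on the slab, while moving
  from \<open>c\<close> by \<open>r\<close> in both perpendicular directions shows that on the ball it has two values that differ
  by \<open>2 r\<close>.\<close>

lemma cball_subset_truncated_slab_radius_le:
  assumes "0 \<le> r" "cball c r \<subseteq> truncated_slab j \<delta> M"
  shows "r \<le> \<delta>"
proof -
  let ?e = "(0, axis j 1) :: real \<times> (real ^ 'a)"
  let ?a = "\<lambda>x. arsinh (minkowski ?e (Rep_hyp x))"
  have coord: "minkowski ?e (Rep_hyp x) = snd (Rep_hyp x) $ j" for x :: "'a hyp"
    by (simp add: minkowski_def inner_axis')
  have bound: "\<bar>?a x\<bar> \<le> \<delta>" if "x \<in> truncated_slab j \<delta> M" for x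
  proof -
    have "sinh \<bar>?a x\<bar> \<le> sinh \<delta>"
      using that by (simp add: truncated_slab_def sinh_real_abs coord)
    then show ?thesis by (simp only: sinh_real_le_iff)
  qed
  obtain q where q: "dist c q = \<bar>r\<bar>" "?a q = ?a c + r"
    using move_perpendicular[OF unit_axis] by blast
  obtain q' where q': "dist c q' = \<bar>- r\<bar>" "?a q' = ?a c + - r"
    using move_perpendicular[OF unit_axis] by blast
  have "\<bar>?a q\<bar> \<le> \<delta>" "\<bar>?a q'\<bar> \<le> \<delta>"
    by (rule bound, rule subsetD[OF assms(2)], simp add: q q' assms(1))+
  then show ?thesis using q q' by linarith
qed

lemma inradius_truncated_slab_le:
  assumes "0 < \<delta>" "cosh \<delta> \<le> M"
  shows "inradius (truncated_slab j \<delta> M) \<le> \<delta>"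
  unfolding inradius_def
proof (rule cSup_least)
  show "{r. 0 \<le> r \<and> (\<exists>c. cball c r \<subseteq> truncated_slab j \<delta> M)} \<noteq> {}"
    using cball_subset_truncated_slab[of \<delta> M j] assms less_imp_le by blast
qed (use cball_subset_truncated_slab_radius_le in blast)

text \<open>In Minkowski space the sum of the two points is a multiple of the origin, which is what makes every
  linear functional at least as large in size at one of them as at the origin.\<close>

lemma exists_opposite_points:
  assumes "1 \<le> M"
  obtains s and a b :: "'n :: finite hyp"
  where "Rep_hyp a = (M, axis i s)" "Rep_hyp b = (M, - axis i s)"
proof -
  define s where "s = sqrt (M * M - 1)"
  have s: "s * s = M * M - 1"
    using mult_mono[OF assms assms] assms by (simp add: s_def)
  have "Rep_hyp (Abs_hyp (M, axis i s)) = (M, axis i s)"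
    "Rep_hyp (Abs_hyp (M, - axis i s)) = (M, - axis i s)"
    by (rule Abs_hyp_inverse, use assms in \<open>simp add: minkowski_def inner_axis_axis s\<close>)+
  then show thesis using that by blast
qed

text \<open>The ball of radius \<open>\<delta>\<close> around the origin keeps the supporting hyperplane at distance at least \<open>\<delta>\<close>
  from the origin. The \<open>sinh\<close> of the signed distance is linear in Minkowski space, where the origin is
  the midpoint of two far points of the slab divided by \<open>M\<close>; so at one of these points it is at least \<open>M\<close> times
  as large as at the origin.\<close>

lemma lassak_width_truncated_slab_ge:
  fixes i j :: "'n :: finite"
  assumes "i \<noteq> j" and \<delta>: "0 < \<delta>" "cosh \<delta> \<le> M" and M: "sinh w \<le> M * sinh \<delta>"
    and H: "supporting_hyperplane (truncated_slab j \<delta> M) H"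
  shows "w \<le> lassak_width (truncated_slab j \<delta> M) H"
proof -
  let ?K = "truncated_slab j \<delta> M"
  obtain v where v: "minkowski v v = 1" "H = hyp_hyperplane v" "?K \<subseteq> hyp_halfspace v"
    using supporting_hyperplane_unit_normal[OF H] by blast
  have neg: "minkowski v (Rep_hyp x) \<le> 0" if "x \<in> ?K" for x
    using v that by (auto simp: hyp_halfspace_def)
  have M1: "1 \<le> M" using \<delta> cosh_real_ge_1[of \<delta>] by linarith
  obtain q where q: "dist hyp_origin q = \<bar>\<delta>\<bar>"
      "arsinh (minkowski v (Rep_hyp q)) = arsinh (minkowski v (Rep_hyp hyp_origin)) + \<delta>"
    using move_perpendicular[OF v(1)] by blast
  have "q \<in> ?K"
    using q \<delta> cball_subset_truncated_slab[of \<delta> M j] by auto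
  then have "sinh (arsinh (minkowski v (Rep_hyp q))) \<le> sinh 0" using neg by simp
  then have "arsinh (minkowski v (1, 0)) \<le> - \<delta>"
    using q(2) by (simp only: sinh_real_le_iff) simp
  then have "sinh (arsinh (minkowski v (1, 0))) \<le> sinh (- \<delta>)"
    by (simp only: sinh_real_le_iff)
  then have o: "minkowski v (1, 0) \<le> - sinh \<delta>" by simp
  obtain s and a b :: "'n hyp"
    where ab: "Rep_hyp a = (M, axis i s)" "Rep_hyp b = (M, - axis i s)"
    using exists_opposite_points[OF M1] by blast
  have abK: "a \<in> ?K" "b \<in> ?K"
    using \<delta> \<open>i \<noteq> j\<close> by (simp_all add: truncated_slab_def ab axis_def)
  have "minkowski v (Rep_hyp a) + minkowski v (Rep_hyp b) = 2 * M * minkowski v (1, 0)"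
    by (simp add: ab minkowski_def)
  also have "\<dots> \<le> 2 * M * - sinh \<delta>"
    using M1 o by (intro mult_left_mono) auto
  finally have "minkowski v (Rep_hyp a) \<le> - sinh w \<or> minkowski v (Rep_hyp b) \<le> - sinh w"
    using M by linarith
  then obtain x where "x \<in> ?K" "sinh w \<le> \<bar>minkowski v (Rep_hyp x)\<bar>"
    using abK by force
  then show ?thesis
    using lassak_width_ge[OF v(1)] H v(2)
    by (simp add: supporting_hyperplane_def compact_imp_bounded compact_truncated_slab)
qed

text \<open>Without a supporting hyperplane the minimal width would be an infimum over the empty set. The
  hyperplane perpendicular to the \<open>j\<close>-th coordinate geodesic at distance \<open>\<delta>\<close> from the origin supports
  the slab: it is \<open>x\<^sub>j = tanh \<delta> * x\<^sub>0\<close>, and \<open>x\<^sub>j / x\<^sub>0 \<le> x\<^sub>j / sqrt (1 + x\<^sub>j\<^sup>2) \<le> tanh \<delta>\<close> for the points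
  of the slab with \<open>x\<^sub>j \<ge> 0\<close>.\<close>

lemma ex_supporting_hyperplane_truncated_slab:
  assumes \<delta>: "0 < \<delta>" "cosh \<delta> \<le> M"
  shows "\<exists>H. supporting_hyperplane (truncated_slab j \<delta> M) H"
proof -
  let ?v = "(sinh \<delta>, axis j (cosh \<delta>)) :: real \<times> (real ^ 'a)"
  have vv: "minkowski ?v ?v = 1"
    using hyperbolic_pythagoras[of \<delta>] by (simp add: minkowski_def inner_axis_axis power2_eq_square)
  have "minkowski (cosh \<delta>, axis j (sinh \<delta>) :: real ^ 'a) (cosh \<delta>, axis j (sinh \<delta>)) = - 1"
    using hyperbolic_pythagoras[of \<delta>] by (simp add: minkowski_def inner_axis_axis power2_eq_square)
  then have p: "Rep_hyp (Abs_hyp (cosh \<delta>, axis j (sinh \<delta>))) = (cosh \<delta>, axis j (sinh \<delta>))"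
    by (intro Abs_hyp_inverse) simp
  have "Abs_hyp (cosh \<delta>, axis j (sinh \<delta>)) \<in> hyp_hyperplane ?v \<inter> truncated_slab j \<delta> M"
    using \<delta> by (simp add: hyp_hyperplane_def truncated_slab_def p minkowski_def inner_axis_axis)
  moreover have "truncated_slab j \<delta> M \<subseteq> hyp_halfspace ?v"
  proof
    fix x :: "'a hyp" assume "x \<in> truncated_slab j \<delta> M"
    define y where "y = snd (Rep_hyp x) $ j"
    have "\<bar>y\<bar> \<le> sinh \<delta>" using \<open>x \<in> _\<close> by (simp add: truncated_slab_def y_def)
    then have "\<bar>y\<bar>\<^sup>2 \<le> (sinh \<delta>)\<^sup>2" by (intro power_mono) auto
    then have y: "y\<^sup>2 \<le> (sinh \<delta>)\<^sup>2" by simp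
    have "\<bar>y\<bar>\<^sup>2 \<le> (norm (snd (Rep_hyp x)))\<^sup>2"
      unfolding y_def by (intro power_mono component_le_norm_cart) simp
    then have "1 + y\<^sup>2 \<le> (fst (Rep_hyp x))\<^sup>2"
      by (simp add: fst_Rep_hyp power2_norm_eq_inner)
    then have "(sinh \<delta>)\<^sup>2 * (1 + y\<^sup>2) \<le> (sinh \<delta>)\<^sup>2 * (fst (Rep_hyp x))\<^sup>2"
      by (intro mult_left_mono) auto
    moreover have "(cosh \<delta> * y)\<^sup>2 = y\<^sup>2 + (sinh \<delta>)\<^sup>2 * y\<^sup>2"
      by (simp add: power_mult_distrib cosh_square_eq algebra_simps)
    ultimately have "(cosh \<delta> * y)\<^sup>2 \<le> (sinh \<delta> * fst (Rep_hyp x))\<^sup>2"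
      using y by (simp add: power_mult_distrib algebra_simps)
    then have "cosh \<delta> * y \<le> sinh \<delta> * fst (Rep_hyp x)"
      by (rule power2_le_imp_le) (simp add: \<delta> less_imp_le)
    then show "x \<in> hyp_halfspace ?v"
      by (simp add: hyp_halfspace_def minkowski_def inner_axis' y_def)
  qed
  ultimately show ?thesis
    unfolding supporting_hyperplane_def using vv
    by (intro exI[of _ "hyp_hyperplane ?v"] conjI exI[of _ ?v]) auto
qed

lemma min_lassak_width_truncated_slab_ge:
  fixes i j :: "'n :: finite"
  assumes "i \<noteq> j" "0 < \<delta>" "cosh \<delta> \<le> M" "sinh w \<le> M * sinh \<delta>"
  shows "w \<le> min_lassak_width (truncated_slab j \<delta> M)"
  unfolding min_lassak_width_def
  using ex_supporting_hyperplane_truncated_slab[of \<delta> M j] lassak_width_truncated_slab_ge assms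
  by (intro cINF_greatest) auto


section \<open>Wide bodies of small inradius\<close>

theorem corollary3p3:
  fixes w :: real
  assumes "w > 0" and "CARD('n :: finite) \<ge> 2"
  shows "Inf {inradius K | K :: 'n hyp set. convex_body K \<and> min_lassak_width K \<ge> w} = 0"
proof -
  let ?R = "{inradius K | K :: 'n hyp set. convex_body K \<and> min_lassak_width K \<ge> w}"
  have lower: "0 \<le> r" if "r \<in> ?R" for r
    using that inradius_nonneg by auto
  have "\<not> is_singleton (UNIV :: 'n set)"
    using assms(2) by (auto simp: is_singleton_altdef)
  then obtain i j :: 'n where ij: "i \<noteq> j"
    using is_singletonI'[of "UNIV :: 'n set"] by blast
  have small: "\<exists>r \<in> ?R. r \<le> \<delta>" if \<delta>: "0 < \<delta>" for \<delta>
  proof -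
    define M where "M = max (cosh \<delta>) (sinh w / sinh \<delta>)"
    have "cosh \<delta> \<le> M" "sinh w / sinh \<delta> \<le> M" by (simp_all add: M_def)
    then have M: "cosh \<delta> \<le> M" "sinh w \<le> M * sinh \<delta>"
      using \<delta> by (simp_all add: divide_le_eq)
    then show ?thesis
      using convex_body_truncated_slab[OF \<delta> M(1), of j] inradius_truncated_slab_le[OF \<delta> M(1), of j]
        min_lassak_width_truncated_slab_ge[OF ij \<delta> M] by blast
  qed
  have bdd: "bdd_below ?R" using lower by (rule bdd_belowI)
  show ?thesis
  proof (rule antisym)
    show "Inf ?R \<le> 0"
    proof (rule field_le_epsilon)
      fix e :: real assume "0 < e"
      then obtain r where "r \<in> ?R" "r \<le> e" using small by blast
      then show "Inf ?R \<le> 0 + e" using cInf_lower[OF _ bdd] by fastforce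
    qed
    show "0 \<le> Inf ?R"
      using small[of 1] lower by (intro cInf_greatest) auto
  qed
qed

end
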